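(* Let $(X,\mu)$ be a standard probability space and let $G$ be a $\mu$-preserving locally finite Borel graph on $X$ with finite cost, i.e. $\operatorname{cost}(G)=\frac12\int_X |G_x|\,d\mu(x)<\infty$. Then there is a $\mu$-conull $G$-invariant Borel set $A\subseteq X$ such that the induced subgraph $G\restriction A$ admits a Borel unfriendly coloring.
   Context: A standard probability space $(X,\mu)$ is a standard Borel space $X$ together with a Borel probability measure $\mu$ on $X$. A Borel graph $G$ on $X$ is a simple undirected graph with vertex set $X$ whose edge relation (a symmetric irreflexive subset of $X\times X$, also denoted $G$) is Borel. For $x\in X$, $G_x=\{y\in X : (x,y)\in G\}$ is the set of $G$-neighbors of $x$; $G$ is locally finite if every $G_x$ is finite. $E_G$ denotes the connectedness equivalence relation of $G$ (lying in the same connected component). A set $A\subseteq X$ is $G$-invariant if it is a union of connected components of $G$; it is $\mu$-conull if $\mu(X\setminus A)=0$. $G$ is $\mu$-preserving if there are countably many $\mu$-preserving Borel involutions of $X$ whose graphs cover the edges of $G$; equivalently, $E_G$ is a $\mu$-preserving equivalence relation. The cost of a $\mu$-preserving locally finite Borel graph $G$ is half of its average degree: $\operatorname{cost}(G)=\frac12\int_X|G_x|\,d\mu(x)$. An unfriendly coloring of a locally finite graph $H$ on a vertex set $Y$ is a function $c: Y\to 2=\{0,1\}$ such that for all $x\in Y$, $|\{y\in H_x : c(x)\ne c(y)\}|\ge|\{y\in H_x : c(x)=c(y)\}|$. It is a Borel unfriendly coloring if $c$ is a Borel function. *)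

theory Defs
  imports "HOL-Probability.Probability"
begin

text \<open>The underlying space of a measure \<open>M\<close> is standard Borel if its \<open>\<sigma>\<close>-algebra is generated by the
  open sets of some Polish topology on \<open>space M\<close>.\<close>

definition standard_borel :: "'a measure \<Rightarrow> bool" where
  "standard_borel M \<longleftrightarrow>
     (\<exists>T. completely_metrizable_space T \<and> separable_space T \<and> topspace T = space M \<and>
          sets M = sigma_sets (topspace T) {U. openin T U})"

definition standard_prob_space :: "'a measure \<Rightarrow> bool" where
  "standard_prob_space M \<longleftrightarrow> standard_borel M \<and> prob_space M"

text \<open>A graph is given by its edge relation \<open>G\<close>; the vertex set is \<open>space M\<close>. Membership of \<open>G\<close> in the
  product \<open>\<sigma>\<close>-algebra entails \<open>G \<subseteq> space M \<times> space M\<close>. The neighbours of \<open>x\<close> are \<open>G `` {x}\<close>.\<close>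

definition borel_graph :: "'a measure \<Rightarrow> ('a \<times> 'a) set \<Rightarrow> bool" where
  "borel_graph M G \<longleftrightarrow> G \<in> sets (M \<Otimes>\<^sub>M M) \<and> sym G \<and> irrefl G"

definition locally_finite_graph :: "'a set \<Rightarrow> ('a \<times> 'a) set \<Rightarrow> bool" where
  "locally_finite_graph Y H \<longleftrightarrow> (\<forall>x\<in>Y. finite (H `` {x}))"

definition mp_involution :: "'a measure \<Rightarrow> ('a \<Rightarrow> 'a) \<Rightarrow> bool" where
  "mp_involution M f \<longleftrightarrow>
     f \<in> measurable M M \<and> (\<forall>x\<in>space M. f (f x) = x) \<and> distr M M f = M"

definition mp_graph :: "'a measure \<Rightarrow> ('a \<times> 'a) set \<Rightarrow> bool" where
  "mp_graph M G \<longleftrightarrow>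
     (\<exists>F. countable F \<and> (\<forall>f\<in>F. mp_involution M f) \<and>
          G \<subseteq> (\<Union>f\<in>F. {(x, f x) | x. x \<in> space M}))"

text \<open>\<open>card\<close> gives 0 on infinite sets, so this is the cost only for locally finite \<open>G\<close>.\<close>

definition graph_cost :: "'a measure \<Rightarrow> ('a \<times> 'a) set \<Rightarrow> ennreal" where
  "graph_cost M G = (1 / 2) * (\<integral>\<^sup>+ x. of_nat (card (G `` {x})) \<partial>M)"

definition connectedness :: "'a set \<Rightarrow> ('a \<times> 'a) set \<Rightarrow> ('a \<times> 'a) set" where
  "connectedness Y H = H\<^sup>* \<inter> Y \<times> Y"

definition invariant_set :: "'a set \<Rightarrow> ('a \<times> 'a) set \<Rightarrow> 'a set \<Rightarrow> bool" where
  "invariant_set Y H A \<longleftrightarrow> (\<exists>\<C> \<subseteq> Y // connectedness Y H. A = \<Union>\<C>)"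

definition induced_graph :: "('a \<times> 'a) set \<Rightarrow> 'a set \<Rightarrow> ('a \<times> 'a) set" where
  "induced_graph H A = H \<inter> A \<times> A"

text \<open>As with the cost, the cardinalities are meaningful only for locally finite \<open>H\<close>.\<close>

definition unfriendly_coloring :: "'a set \<Rightarrow> ('a \<times> 'a) set \<Rightarrow> ('a \<Rightarrow> nat) \<Rightarrow> bool" where
  "unfriendly_coloring Y H c \<longleftrightarrow>
     c \<in> Y \<rightarrow> {0, 1} \<and>
     (\<forall>x\<in>Y. card {y \<in> H `` {x}. c x \<noteq> c y} \<ge> card {y \<in> H `` {x}. c x = c y})"

definition borel_unfriendly_coloring ::
    "'a measure \<Rightarrow> ('a \<times> 'a) set \<Rightarrow> ('a \<Rightarrow> nat) \<Rightarrow> bool" where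
  "borel_unfriendly_coloring N H c \<longleftrightarrow>
     unfriendly_coloring (space N) H c \<and> c \<in> measurable N (count_space {0, 1})"

end

theory Submission
  imports Defs
begin

text \<open>Start from an arbitrary coloring and process a sequence of independent Borel sets that
  exhausts the vertices infinitely often; at each step flip the vertices of the current set which
  have more friendly than unfriendly neighbours. Since \<open>G\<close> preserves the measure, every flip of a
  set \<open>S\<close> lowers the integral of the number of friendly neighbours by at least twice the measure of
  \<open>S\<close>. This integral is finite at the start, so by Borel--Cantelli almost every vertex is flipped
  finitely often. By local finiteness the limit coloring is unfriendly away from the saturation of
  a null set.\<close>

section \<open>Countable separating families in standard Borel spaces\<close>

text \<open>The balls with center in a countable dense set and radius of the form 1/(n+1) form a
  base.\<close>

lemma metrizable_separable_imp_second_countable: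
  assumes "metrizable_space T" "separable_space T"
  shows "second_countable T"
proof -
  obtain X d where "Metric_space X d" and T: "T = Metric_space.mtopology X d"
    using assms(1) unfolding metrizable_space_def by blast
  interpret Metric_space X d by fact
  obtain C where C: "countable C" "C \<subseteq> X" "mtopology closure_of C = X"
    using assms(2) unfolding separable_space_def T topspace_mtopology by blast
  define \<B> where "\<B> = (\<lambda>(c, n). mball c (inverse (Suc n))) ` (C \<times> (UNIV :: nat set))"
  have base: "\<exists>V\<in>\<B>. x \<in> V \<and> V \<subseteq> W" if W: "openin mtopology W" "x \<in> W" for W x
  proof -
    obtain r where r: "r > 0" "mball x r \<subseteq> W" using W unfolding openin_mtopology by blast
    \<comment> \<open>With radius and distance of the centers both below \<open>r / 2\<close>, the
      triangle inequality keeps the small ball inside \<open>mball x r\<close>.\<close>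
    obtain n where n: "inverse (Suc n) < r / 2"
      using reals_Archimedean[of "r / 2"] r(1) by auto
    have x: "x \<in> X" using W openin_subset by fastforce
    then have "x \<in> mtopology closure_of C" using C(3) by simp
    then obtain c where c: "c \<in> C" "c \<in> mball x (inverse (Suc n))"
      unfolding metric_closure_of by (auto dest!: spec[of _ "inverse (real (Suc n))"])
    have dist: "d x c < inverse (Suc n)" "d c x = d x c" "c \<in> X"
      using c(2) commute by auto
    then have "x \<in> mball c (inverse (Suc n))" using x by simp
    moreover have "mball c (inverse (Suc n)) \<subseteq> mball x r"
    proof (rule mball_subset)
      show "d c x + inverse (Suc n) \<le> r" using dist n by linarith
    qed (rule x)
    moreover have "mball c (inverse (Suc n)) \<in> \<B>"
      unfolding \<B>_def using c(1) by (intro image_eqI[of _ _ "(c, n)"]) auto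
    ultimately show ?thesis using r(2) by (meson order_trans)
  qed
  show ?thesis
    unfolding second_countable_def T
  proof (intro exI[of _ \<B>] conjI)
    show "countable \<B>" unfolding \<B>_def using C(1) by simp
    show "\<forall>V\<in>\<B>. openin mtopology V" unfolding \<B>_def by auto
  qed (use base in blast)
qed

text \<open>All that is needed from the Polish topology. Finite sets are closed in a Hausdorff
  space, so some member of a countable base contains \<open>x\<close> and misses
  \<open>Y\<close>.\<close>

lemma standard_borel_separating_sets:
  assumes "standard_borel M"
  obtains U :: "nat \<Rightarrow> 'a set"
  where "\<And>k. U k \<in> sets M"
    and "\<And>x Y. x \<in> space M \<Longrightarrow> finite Y \<Longrightarrow> x \<notin> Y \<Longrightarrow> \<exists>k. x \<in> U k \<and> U k \<inter> Y = {}"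
proof -
  obtain T where T: "completely_metrizable_space T" "separable_space T" "topspace T = space M"
    and sets: "sets M = sigma_sets (topspace T) {U. openin T U}"
    using assms unfolding standard_borel_def by blast
  have met: "metrizable_space T"
    using T(1) by (rule completely_metrizable_imp_metrizable_space)
  then have "second_countable T"
    using T(2) by (rule metrizable_separable_imp_second_countable)
  then obtain \<B> where B: "countable \<B>" "\<And>V. V \<in> \<B> \<Longrightarrow> openin T V"
    and base: "\<And>U x. openin T U \<Longrightarrow> x \<in> U \<Longrightarrow> \<exists>V\<in>\<B>. x \<in> V \<and> V \<subseteq> U"
    unfolding second_countable_def by metis
  \<comment> \<open>Inserting the empty set makes the family nonempty, so that
    \<open>from_nat_into\<close> enumerates exactly it.\<close>
  define U where "U = from_nat_into (insert {} \<B>)"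
  have range: "range U = insert {} \<B>"
    unfolding U_def using B(1) by (intro range_from_nat_into) auto
  show thesis
  proof (rule that)
    show "U k \<in> sets M" for k
    proof -
      have "U k \<in> insert {} \<B>" using range by blast
      then have "openin T (U k)" using B(2) by auto
      then show ?thesis unfolding sets by blast
    qed
  next
    fix x Y assume *: "x \<in> space M" "finite Y" "x \<notin> Y"
    have "closedin T (topspace T \<inter> Y)"
      using * metrizable_imp_Hausdorff_space[OF met]
      by (intro closedin_Hausdorff_finite) auto
    then have "openin T (topspace T - topspace T \<inter> Y)" by blast
    then obtain V where V: "V \<in> \<B>" "x \<in> V" "V \<subseteq> topspace T - topspace T \<inter> Y"
      using base[of "topspace T - topspace T \<inter> Y" x] * T(3) by auto
    then obtain k where "U k = V" using range by (metis insertCI rangeE)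
    then show "\<exists>k. x \<in> U k \<and> U k \<inter> Y = {}" using V by blast
  qed
qed

section \<open>Measure-preserving graphs and sums over neighbours\<close>

locale mp_borel_graph = prob_space M for M :: "'a measure" +
  fixes G :: "('a \<times> 'a) set" and f :: "nat \<Rightarrow> 'a \<Rightarrow> 'a" and U :: "nat \<Rightarrow> 'a set"
  assumes G_sets [measurable]: "G \<in> sets (M \<Otimes>\<^sub>M M)"
    and G_sym: "sym G" and G_irrefl: "irrefl G"
    and finite_nbrs: "x \<in> space M \<Longrightarrow> finite (G `` {x})"
    and f_measurable [measurable]: "f n \<in> measurable M M"
    and f_f: "x \<in> space M \<Longrightarrow> f n (f n x) = x"
    and distr_f: "distr M M (f n) = M"
    and G_cover: "(x, y) \<in> G \<Longrightarrow> \<exists>n. y = f n x"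
    and U_sets [measurable]: "U k \<in> sets M"
    and U_separates: "x \<in> space M \<Longrightarrow> finite Y \<Longrightarrow> x \<notin> Y \<Longrightarrow> \<exists>k. x \<in> U k \<and> U k \<inter> Y = {}"
begin

lemma f_space: "x \<in> space M \<Longrightarrow> f n x \<in> space M"
  using f_measurable by (rule measurable_space)

lemma G_space: "(x, y) \<in> G \<Longrightarrow> x \<in> space M \<and> y \<in> space M"
  using sets.sets_into_space[OF G_sets] by (auto simp: space_pair_measure)

lemma G_symD: "(x, y) \<in> G \<Longrightarrow> (y, x) \<in> G"
  using G_sym by (rule symD)

text \<open>Turns equality of points into countably many Borel conditions, which makes
  \<open>D n\<close> measurable. One direction of implication suffices, since some
  \<open>U k\<close> contains \<open>x\<close> but not a given other point.\<close>

lemma eq_iff_separated: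
  assumes "x \<in> space M" shows "x = y \<longleftrightarrow> (\<forall>k. x \<in> U k \<longrightarrow> y \<in> U k)"
  using U_separates[of x "{y}"] assms by auto

text \<open>Taking the least index counts each edge at \<open>x\<close> once even if several \<open>f n\<close> represent it.\<close>

definition D :: "nat \<Rightarrow> 'a set" where
  "D n = {x \<in> space M. (x, f n x) \<in> G \<and> (\<forall>m<n. f m x \<noteq> f n x)}"

lemma D_sets [measurable]: "D n \<in> sets M"
proof -
  have "D n = {x \<in> space M. (x, f n x) \<in> G \<and> (\<forall>m<n. \<not> (\<forall>k. f m x \<in> U k \<longrightarrow> f n x \<in> U k))}"
    unfolding D_def using eq_iff_separated f_space by blast
  also have "\<dots> \<in> sets M" by measurable
  finally show ?thesis .
qed

text \<open>As \<open>f m\<close> and \<open>f n\<close> are involutions,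
  \<open>f m (f n x) = x\<close> iff \<open>f m x = f n x\<close>; hence an edge has the same least
  index from both ends.\<close>

lemma f_mem_D: "x \<in> space M \<Longrightarrow> f n x \<in> D n \<longleftrightarrow> x \<in> D n"
proof -
  have "f m (f n x) = x \<longleftrightarrow> f m x = f n x" if "x \<in> space M" for m x
    using f_f f_space that by metis
  then show "x \<in> space M \<Longrightarrow> f n x \<in> D n \<longleftrightarrow> x \<in> D n"
    unfolding D_def using f_f f_space G_symD by auto
qed

lemma bij_betw_D_nbrs:
  assumes x: "x \<in> space M"
  shows "bij_betw (\<lambda>n. f n x) {n. x \<in> D n} (G `` {x})"
proof (rule bij_betw_imageI)
  show "inj_on (\<lambda>n. f n x) {n. x \<in> D n}"
  proof (rule inj_onI)
    fix m n assume "m \<in> {n. x \<in> D n}" "n \<in> {n. x \<in> D n}" "f m x = f n x"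
    then show "m = n" unfolding D_def by (cases m n rule: linorder_cases) auto
  qed
  show "(\<lambda>n. f n x) ` {n. x \<in> D n} = G `` {x}"
  proof
    show "(\<lambda>n. f n x) ` {n. x \<in> D n} \<subseteq> G `` {x}" unfolding D_def by auto
    show "G `` {x} \<subseteq> (\<lambda>n. f n x) ` {n. x \<in> D n}"
    proof
      fix y assume "y \<in> G `` {x}"
      then have y: "(x, y) \<in> G" by simp
      define n where "n = (LEAST n. y = f n x)"
      have n: "y = f n x" unfolding n_def using G_cover[OF y] by (rule LeastI_ex)
      have "f m x \<noteq> y" if "m < n" for m
        using not_less_Least that unfolding n_def by metis
      then have "x \<in> D n" unfolding D_def using n y x by auto
      then show "y \<in> (\<lambda>n. f n x) ` {n. x \<in> D n}" using n by blast
    qed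
  qed
qed

text \<open>Replaces an index set that varies with \<open>x\<close> by a fixed one, so that
  measurability and integration can be treated term by term.\<close>

lemma sum_nbrs_eq_suminf:
  fixes w :: "'a \<Rightarrow> ennreal"
  assumes x: "x \<in> space M"
  shows "(\<Sum>y\<in>G `` {x}. w y) = (\<Sum>n. indicator (D n) x * w (f n x))"
proof -
  have fin: "finite {n. x \<in> D n}"
    using bij_betw_finite[OF bij_betw_D_nbrs[OF x]] finite_nbrs[OF x] by simp
  have "(\<Sum>y\<in>G `` {x}. w y) = (\<Sum>n | x \<in> D n. w (f n x))"
    by (rule sum.reindex_bij_betw[OF bij_betw_D_nbrs[OF x], symmetric])
  also have "\<dots> = (\<Sum>n | x \<in> D n. indicator (D n) x * w (f n x))"
    by (rule sum.cong) auto
  also have "\<dots> = (\<Sum>n. indicator (D n) x * w (f n x))"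
    by (rule suminf_finite[symmetric, OF fin]) auto
  finally show ?thesis .
qed

lemma measurable_sum_nbrs [measurable]:
  assumes [measurable]: "case_prod w \<in> borel_measurable (M \<Otimes>\<^sub>M M)"
  shows "(\<lambda>x. \<Sum>y\<in>G `` {x}. (w x y :: ennreal)) \<in> borel_measurable M"
proof -
  have "(\<lambda>x. \<Sum>n. indicator (D n) x * w x (f n x)) \<in> borel_measurable M"
    by measurable
  then show ?thesis by (simp cong: measurable_cong add: sum_nbrs_eq_suminf)
qed

section \<open>Integrals over edges and mass transport\<close>

text \<open>The integral over ordered edges: each undirected edge contributes in both directions.
  With weight \<open>fr C\<close> it is the energy that flips lower.\<close>

definition edge_integral :: "('a \<Rightarrow> 'a \<Rightarrow> ennreal) \<Rightarrow> ennreal" where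
  "edge_integral w = (\<integral>\<^sup>+x. (\<Sum>y\<in>G `` {x}. w x y) \<partial>M)"

lemma edge_integral_eq_suminf:
  assumes [measurable]: "case_prod w \<in> borel_measurable (M \<Otimes>\<^sub>M M)"
  shows "edge_integral w = (\<Sum>n. \<integral>\<^sup>+x. indicator (D n) x * w x (f n x) \<partial>M)"
proof -
  have "edge_integral w = (\<integral>\<^sup>+x. (\<Sum>n. indicator (D n) x * w x (f n x)) \<partial>M)"
    unfolding edge_integral_def by (rule nn_integral_cong) (rule sum_nbrs_eq_suminf)
  also have "\<dots> = (\<Sum>n. \<integral>\<^sup>+x. indicator (D n) x * w x (f n x) \<partial>M)"
    by (rule nn_integral_suminf) measurable
  finally show ?thesis .
qed

text \<open>Mass transport: \<open>f n\<close> preserves \<open>M\<close> and \<open>D n\<close> and exchanges the endpoints of \<open>(x, f n x)\<close>.\<close>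

lemma edge_integral_swap:
  assumes [measurable]: "case_prod w \<in> borel_measurable (M \<Otimes>\<^sub>M M)"
  shows "edge_integral (\<lambda>x y. w y x) = edge_integral w"
proof -
  have "(\<integral>\<^sup>+x. indicator (D n) x * w x (f n x) \<partial>M)
      = (\<integral>\<^sup>+x. indicator (D n) x * w (f n x) x \<partial>M)" for n
  proof -
    have "(\<integral>\<^sup>+x. indicator (D n) x * w x (f n x) \<partial>M)
        = (\<integral>\<^sup>+x. indicator (D n) x * w x (f n x) \<partial>distr M M (f n))"
      by (simp add: distr_f)
    also have "\<dots> = (\<integral>\<^sup>+x. indicator (D n) (f n x) * w (f n x) (f n (f n x)) \<partial>M)"
      by (rule nn_integral_distr) measurable
    also have "\<dots> = (\<integral>\<^sup>+x. indicator (D n) x * w (f n x) x \<partial>M)"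
      by (rule nn_integral_cong) (simp add: f_f f_mem_D indicator_def)
    finally show ?thesis .
  qed
  then show ?thesis by (simp add: edge_integral_eq_suminf)
qed

lemma edge_integral_add:
  assumes [measurable]: "case_prod v \<in> borel_measurable (M \<Otimes>\<^sub>M M)"
    "case_prod w \<in> borel_measurable (M \<Otimes>\<^sub>M M)"
  shows "edge_integral (\<lambda>x y. v x y + w x y) = edge_integral v + edge_integral w"
  unfolding edge_integral_def by (simp add: sum.distrib nn_integral_add)

lemma edge_integral_cong:
  assumes "\<And>x y. (x, y) \<in> G \<Longrightarrow> v x y = w x y"
  shows "edge_integral v = edge_integral w"
  unfolding edge_integral_def by (intro nn_integral_cong sum.cong) (auto intro: assms)

lemma edge_integral_le_degree:
  assumes "\<And>x y. w x y \<le> 1"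
  shows "edge_integral w \<le> (\<integral>\<^sup>+x. of_nat (card (G `` {x})) \<partial>M)"
  unfolding edge_integral_def
proof (rule nn_integral_mono)
  fix x
  have "(\<Sum>y\<in>G `` {x}. w x y) \<le> (\<Sum>y\<in>G `` {x}. 1)"
    by (rule sum_mono) (rule assms)
  then show "(\<Sum>y\<in>G `` {x}. w x y) \<le> of_nat (card (G `` {x}))" by simp
qed

section \<open>Effect of a flip on friendly edges\<close>

text \<open>A coloring is represented by the set \<open>C\<close> of vertices of color \<open>1\<close>.\<close>

definition friends :: "'a set \<Rightarrow> 'a \<Rightarrow> 'a set" where
  "friends C x = {y \<in> G `` {x}. x \<in> C \<longleftrightarrow> y \<in> C}"

definition strangers :: "'a set \<Rightarrow> 'a \<Rightarrow> 'a set" where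
  "strangers C x = {y \<in> G `` {x}. \<not> (x \<in> C \<longleftrightarrow> y \<in> C)}"

definition fr :: "'a set \<Rightarrow> 'a \<Rightarrow> 'a \<Rightarrow> ennreal" where
  "fr C x y = (if x \<in> C \<longleftrightarrow> y \<in> C then 1 else 0)"

definition st :: "'a set \<Rightarrow> 'a \<Rightarrow> 'a \<Rightarrow> ennreal" where
  "st C x y = (if x \<in> C \<longleftrightarrow> y \<in> C then 0 else 1)"

lemma fr_measurable [measurable]:
  assumes [measurable]: "C \<in> sets M"
  shows "case_prod (fr C) \<in> borel_measurable (M \<Otimes>\<^sub>M M)"
  unfolding fr_def by measurable

lemma st_measurable [measurable]:
  assumes [measurable]: "C \<in> sets M"
  shows "case_prod (st C) \<in> borel_measurable (M \<Otimes>\<^sub>M M)"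
  unfolding st_def by measurable

lemma sum_fr: "x \<in> space M \<Longrightarrow> (\<Sum>y\<in>G `` {x}. fr C x y) = of_nat (card (friends C x))"
  unfolding fr_def friends_def by (simp add: sum.If_cases finite_nbrs Int_def)

lemma sum_st: "x \<in> space M \<Longrightarrow> (\<Sum>y\<in>G `` {x}. st C x y) = of_nat (card (strangers C x))"
  unfolding st_def strangers_def by (simp add: sum.If_cases finite_nbrs Int_def)

definition unhappy :: "'a set \<Rightarrow> 'a set" where
  "unhappy C = {x \<in> space M. card (strangers C x) < card (friends C x)}"

lemma unhappy_sets [measurable]:
  assumes [measurable]: "C \<in> sets M"
  shows "unhappy C \<in> sets M"
proof -
  have "unhappy C = {x \<in> space M. (\<Sum>y\<in>G `` {x}. st C x y) < (\<Sum>y\<in>G `` {x}. fr C x y)}"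
    unfolding unhappy_def by (auto simp: sum_st sum_fr)
  also have "\<dots> \<in> sets M" by measurable
  finally show ?thesis .
qed

definition independent :: "'a set \<Rightarrow> bool" where
  "independent S \<longleftrightarrow> G \<inter> S \<times> S = {}"

text \<open>Each vertex of \<open>S\<close> has at least one more friend than strangers, and by mass
  transport the edges entering \<open>S\<close> weigh as much as those leaving it, whence the factor
  2. To avoid subtraction in \<open>ennreal\<close>, terms are balanced additively and cancelled at
  the end.\<close>

lemma flip_decreases_friends:
  assumes C [measurable]: "C \<in> sets M" and S [measurable]: "S \<in> sets M"
    and ind: "independent S" and unh: "S \<subseteq> unhappy C"
    and finite_deg: "(\<integral>\<^sup>+x. of_nat (card (G `` {x})) \<partial>M) < \<infinity>"
  shows "edge_integral (fr (sym_diff C S)) + 2 * emeasure M S \<le> edge_integral (fr C)"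
proof -
  let ?F = "\<lambda>x y. indicator S x * fr C x y" and ?H = "\<lambda>x y. indicator S x * st C x y"
  let ?E = edge_integral
  have swapF: "?E (\<lambda>x y. indicator S y * fr C x y) = ?E ?F"
    by (subst edge_integral_swap[symmetric]) (auto simp: fr_def intro!: edge_integral_cong)
  have swapH: "?E (\<lambda>x y. indicator S y * st C x y) = ?E ?H"
    by (subst edge_integral_swap[symmetric]) (auto simp: st_def intro!: edge_integral_cong)
  have "?E (fr (sym_diff C S)) + ?E ?F + ?E ?F
      = ?E (\<lambda>x y. fr (sym_diff C S) x y + ?F x y + indicator S y * fr C x y)"
    by (simp add: edge_integral_add swapF)
  \<comment> \<open>On an edge with one endpoint in \<open>S\<close> the flip exchanges
    \<open>fr\<close> and \<open>st\<close>; with none it changes nothing; independence excludes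
    two.\<close>
  also have "\<dots> = ?E (\<lambda>x y. fr C x y + ?H x y + indicator S y * st C x y)"
    using ind by (intro edge_integral_cong) (auto simp: independent_def fr_def st_def indicator_def)
  also have "\<dots> = ?E (fr C) + ?E ?H + ?E ?H"
    by (simp add: edge_integral_add swapH)
  finally have eq: "?E (fr (sym_diff C S)) + ?E ?F + ?E ?F = ?E (fr C) + ?E ?H + ?E ?H" .
  have "?E ?H + emeasure M S = (\<integral>\<^sup>+x. (\<Sum>y\<in>G `` {x}. ?H x y) + indicator S x \<partial>M)"
    unfolding edge_integral_def by (simp add: nn_integral_add)
  also have "\<dots> \<le> ?E ?F"
    unfolding edge_integral_def
  proof (rule nn_integral_mono)
    fix x assume x: "x \<in> space M"
    show "(\<Sum>y\<in>G `` {x}. ?H x y) + indicator S x \<le> (\<Sum>y\<in>G `` {x}. ?F x y)"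
    proof (cases "x \<in> S")
      case True
      then have "card (strangers C x) + 1 \<le> card (friends C x)"
        using unh unfolding unhappy_def by auto
      then have "(of_nat (card (strangers C x) + 1) :: ennreal) \<le> of_nat (card (friends C x))"
        by (rule of_nat_mono)
      then show ?thesis using True x by (simp add: sum_fr sum_st add.commute)
    qed simp
  qed
  finally have le: "?E ?H + emeasure M S \<le> ?E ?F" .
  have "?E ?H \<le> (\<integral>\<^sup>+x. of_nat (card (G `` {x})) \<partial>M)"
    by (rule edge_integral_le_degree) (auto simp: st_def indicator_def)
  \<comment> \<open>Finite average degree makes the \<open>?H\<close> terms finite, so that they may
    be cancelled.\<close>
  then have fin: "?E ?H + ?E ?H \<noteq> \<infinity>" using finite_deg by (auto simp: top_unique)
  have "(?E ?H + ?E ?H) + (?E (fr (sym_diff C S)) + 2 * emeasure M S)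
      = ?E (fr (sym_diff C S)) + (?E ?H + emeasure M S) + (?E ?H + emeasure M S)"
    by (simp add: mult_2 ac_simps)
  also have "\<dots> \<le> ?E (fr (sym_diff C S)) + ?E ?F + ?E ?F"
    by (intro add_mono le order_refl)
  also have "\<dots> = (?E ?H + ?E ?H) + ?E (fr C)"
    unfolding eq by (simp only: ac_simps)
  finally show ?thesis using fin by (simp add: ennreal_add_left_cancel_le)
qed

section \<open>Independent sets and the sequence of colorings\<close>

definition ind_set :: "nat \<Rightarrow> 'a set" where
  "ind_set k = {x \<in> U k. G `` {x} \<inter> U k = {}}"

lemma independent_ind_set: "independent (ind_set k)"
  unfolding independent_def ind_set_def by auto

lemma ind_set_sets [measurable]: "ind_set k \<in> sets M"
proof -
  have "U k \<subseteq> space M" using sets.sets_into_space[OF U_sets] .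
  \<comment> \<open>Every neighbour of \<open>x\<close> is some \<open>f n x\<close>, so having none
    in \<open>U k\<close> is a countable conjunction.\<close>
  then have "ind_set k = {x \<in> space M. x \<in> U k \<and> (\<forall>n. \<not> ((x, f n x) \<in> G \<and> f n x \<in> U k))}"
    unfolding ind_set_def using G_cover by blast
  also have "\<dots> \<in> sets M" by measurable
  finally show ?thesis .
qed

text \<open>By irreflexivity \<open>x\<close> is not among its finitely many neighbours, so some
  \<open>U k\<close> separates it from them.\<close>

lemma ind_set_cover: "x \<in> space M \<Longrightarrow> \<exists>k. x \<in> ind_set k"
  using U_separates[of x "G `` {x}"] finite_nbrs[of x] G_irrefl
  unfolding ind_set_def irrefl_def by auto

text \<open>Every index occurs infinitely often as \<open>fst (prod_decode k)\<close>.\<close>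

primrec col :: "nat \<Rightarrow> 'a set" where
  "col 0 = {}"
| "col (Suc k) = sym_diff (col k) (ind_set (fst (prod_decode k)) \<inter> unhappy (col k))"

definition flips :: "nat \<Rightarrow> 'a set" where
  "flips k = ind_set (fst (prod_decode k)) \<inter> unhappy (col k)"

lemma col_Suc: "col (Suc k) = sym_diff (col k) (flips k)"
  by (simp add: flips_def)

lemma col_sets [measurable]: "col k \<in> sets M"
  by (induction k) (simp_all, measurable)

lemma flips_sets [measurable]: "flips k \<in> sets M"
  unfolding flips_def by measurable

lemma AE_finitely_many_flips:
  assumes fin: "(\<integral>\<^sup>+x. of_nat (card (G `` {x})) \<partial>M) < \<infinity>"
  shows "AE x in M. eventually (\<lambda>k. x \<notin> flips k) sequentially"
proof -
  let ?d = "\<integral>\<^sup>+x. of_nat (card (G `` {x})) \<partial>M"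
  \<comment> \<open>Telescoped energy balance: what is left after \<open>n\<close> steps plus what
    the flips have spent is at most the total degree.\<close>
  have le: "edge_integral (fr (col n)) + (\<Sum>k<n. 2 * emeasure M (flips k)) \<le> ?d" for n
  proof (induction n)
    case 0
    show ?case by (simp add: edge_integral_le_degree fr_def)
  next
    case (Suc n)
    have "edge_integral (fr (col (Suc n))) + 2 * emeasure M (flips n) \<le> edge_integral (fr (col n))"
      unfolding col_Suc
      by (rule flip_decreases_friends[OF _ _ _ _ fin])
        (use independent_ind_set in \<open>auto simp: flips_def independent_def\<close>)
    then have "edge_integral (fr (col (Suc n))) + 2 * emeasure M (flips n)
        + (\<Sum>k<n. 2 * emeasure M (flips k)) \<le> ?d"
      using Suc.IH by (meson add_right_mono order_trans)
    then show ?case by (simp add: ac_simps del: col.simps)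
  qed
  have "(\<Sum>k. emeasure M (flips k)) \<le> ?d"
  proof (rule suminf_le_const)
    show "(\<Sum>k<n. emeasure M (flips k)) \<le> ?d" for n
    proof -
      have "(\<Sum>k<n. emeasure M (flips k)) \<le> (\<Sum>k<n. 2 * emeasure M (flips k))"
        by (intro sum_mono) (simp add: mult_2)
      also have "\<dots> \<le> ?d" using le[of n] by (meson add_increasing order_refl order_trans zero_le)
      finally show ?thesis .
    qed
  qed simp
  then have "(\<Sum>k. emeasure M (flips k)) < \<infinity>" using fin by (rule le_less_trans)
  then have "summable (\<lambda>k. measure M (flips k))"
    by (intro summable_suminf_not_top) (auto simp: emeasure_eq_measure)
  then have "AE x in M. eventually (\<lambda>k. x \<in> space M - flips k) sequentially"
    by (intro borel_cantelli_AE1) (auto simp: emeasure_eq_measure)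
  then show ?thesis by (auto elim: eventually_mono)
qed

section \<open>The invariant conull core\<close>

definition stable :: "'a set" where
  "stable = {x \<in> space M. eventually (\<lambda>k. x \<notin> flips k) sequentially}"

lemma stable_sets [measurable]: "stable \<in> sets M"
  unfolding stable_def eventually_sequentially by measurable

text \<open>Words in the involutions: countably many measure-preserving maps that carry a vertex to
  every vertex of its component.\<close>

definition orbit_map :: "nat list \<Rightarrow> 'a \<Rightarrow> 'a" where
  "orbit_map ns = foldr f ns"

lemma orbit_map_Cons: "orbit_map (n # ns) = f n \<circ> orbit_map ns"
  by (simp add: orbit_map_def)

lemma orbit_map_measurable [measurable]: "orbit_map ns \<in> measurable M M"
proof (induction ns)
  case Nil
  show ?case by (simp add: orbit_map_def id_def)
next
  case (Cons n ns)
  show ?case unfolding orbit_map_Cons by (rule measurable_comp[OF Cons f_measurable])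
qed

lemma distr_orbit_map: "distr M M (orbit_map ns) = M"
proof (induction ns)
  case Nil
  show ?case by (simp add: orbit_map_def id_def distr_id)
next
  case (Cons n ns)
  have "distr M M (orbit_map (n # ns)) = distr (distr M M (orbit_map ns)) M (f n)"
    by (simp add: distr_distr orbit_map_Cons)
  then show ?case using Cons distr_f by simp
qed

text \<open>Stability is asked along the whole orbit under the \<open>f n\<close>, which may exceed
  the component; this makes the condition a countable intersection of Borel sets.\<close>

definition core :: "'a set" where
  "core = {x \<in> space M. \<forall>ns. orbit_map ns x \<in> stable}"

lemma core_sets [measurable]: "core \<in> sets M"
  unfolding core_def by measurable

lemma core_stable: "x \<in> core \<Longrightarrow> x \<in> stable"
  unfolding core_def orbit_map_def by (auto dest: spec[of _ "[]"])

lemma core_closed: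
  assumes "x \<in> core" "(x, y) \<in> G" shows "y \<in> core"
proof -
  obtain n where n: "y = f n x" using G_cover assms by blast
  \<comment> \<open>\<open>foldr\<close> applies the last letter first, so the step from
    \<open>x\<close> to \<open>y\<close> goes at the end of the word.\<close>
  have "orbit_map ns y = orbit_map (ns @ [n]) x" for ns by (simp add: orbit_map_def n)
  then show ?thesis using assms G_space unfolding core_def by auto
qed

text \<open>\<open>stable\<close> is conull, hence so are its preimages under countably many
  measure-preserving maps and their intersection.\<close>

lemma emeasure_core_compl:
  assumes fin: "(\<integral>\<^sup>+x. of_nat (card (G `` {x})) \<partial>M) < \<infinity>"
  shows "emeasure M (space M - core) = 0"
proof -
  have st: "AE x in M. x \<in> stable"
    using AE_finitely_many_flips[OF fin] by (auto simp: stable_def)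
  have "AE x in M. orbit_map ns x \<in> stable" for ns
  proof -
    have "AE x in distr M M (orbit_map ns). x \<in> stable" using st by (simp only: distr_orbit_map)
    then show ?thesis by (subst (asm) AE_distr_iff) auto
  qed
  then have "AE x in M. \<forall>ns. orbit_map ns x \<in> stable" by (simp add: AE_all_countable)
  then have "AE x in M. x \<in> core" by (auto simp: core_def)
  then show ?thesis by (subst (asm) AE_iff_measurable[where N="space M - core"]) auto
qed

lemma invariant_core: "invariant_set (space M) G core"
proof -
  let ?E = "connectedness (space M) G"
  have closed: "y \<in> core" if "(x, y) \<in> G\<^sup>*" "x \<in> core" for x y
    using that by (induction rule: rtrancl_induct) (auto intro: core_closed)
  have sub: "core \<subseteq> space M" unfolding core_def by blast
  have "core // ?E \<subseteq> space M // ?E" using sub unfolding quotient_def by blast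
  moreover have "core = \<Union>(core // ?E)"
    using sub closed unfolding quotient_def connectedness_def by auto
  ultimately show ?thesis unfolding invariant_set_def by blast
qed

section \<open>The limit coloring\<close>

text \<open>A vertex whose color does not settle gets color 0 by default; this can happen only
  outside \<open>stable\<close>.\<close>

definition limit_col :: "'a set" where
  "limit_col = {x \<in> space M. eventually (\<lambda>k. x \<in> col k) sequentially}"

lemma limit_col_sets [measurable]: "limit_col \<in> sets M"
  unfolding limit_col_def eventually_sequentially by measurable

lemma eventually_col_eq_limit:
  assumes "x \<in> stable"
  shows "eventually (\<lambda>k. x \<in> col k \<longleftrightarrow> x \<in> limit_col) sequentially"
proof -
  obtain K where K: "\<And>k. k \<ge> K \<Longrightarrow> x \<notin> flips k"
    using assms unfolding stable_def eventually_sequentially by blast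
  have const: "x \<in> col k \<longleftrightarrow> x \<in> col K" if "k \<ge> K" for k
    using that by (induction rule: dec_induct) (use K in \<open>auto simp: col_Suc simp del: col.simps\<close>)
  have "x \<in> limit_col \<longleftrightarrow> x \<in> col K"
  proof
    assume "x \<in> limit_col"
    then obtain L where "\<And>k. k \<ge> L \<Longrightarrow> x \<in> col k"
      unfolding limit_col_def eventually_sequentially by blast
    then have "x \<in> col (max K L)" by simp
    then show "x \<in> col K" using const[of "max K L"] by simp
  next
    assume "x \<in> col K"
    then show "x \<in> limit_col"
      using assms const unfolding limit_col_def stable_def eventually_sequentially by blast
  qed
  then show ?thesis unfolding eventually_sequentially using const by blast
qed

text \<open>By local finiteness, from some time on \<open>x\<close> and all its neighbours have
  their limit colors. An independent set containing \<open>x\<close> is processed after that time;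
  as \<open>x\<close> is not flipped then, it is not unhappy.\<close>

lemma limit_col_happy:
  assumes x: "x \<in> core"
  shows "card (friends limit_col x) \<le> card (strangers limit_col x)"
proof -
  have xs: "x \<in> space M" using x unfolding core_def by blast
  have "eventually (\<lambda>k. \<forall>y\<in>insert x (G `` {x}). y \<in> col k \<longleftrightarrow> y \<in> limit_col) sequentially"
    using finite_nbrs[OF xs] core_closed[OF x] x
    by (intro eventually_ball_finite) (auto intro: eventually_col_eq_limit core_stable)
  moreover have "eventually (\<lambda>k. x \<notin> flips k) sequentially"
    using core_stable[OF x] unfolding stable_def by blast
  ultimately have "eventually (\<lambda>k. (\<forall>y\<in>insert x (G `` {x}). y \<in> col k \<longleftrightarrow> y \<in> limit_col)
      \<and> x \<notin> flips k) sequentially"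
    by (rule eventually_conj)
  then obtain K where K: "\<And>k. k \<ge> K \<Longrightarrow>
      (\<forall>y\<in>insert x (G `` {x}). y \<in> col k \<longleftrightarrow> y \<in> limit_col) \<and> x \<notin> flips k"
    unfolding eventually_sequentially by blast
  obtain j where j: "x \<in> ind_set j" using ind_set_cover[OF xs] by blast
  \<comment> \<open>A step that processes \<open>ind_set j\<close> and comes no earlier than
    \<open>K\<close>.\<close>
  define k where "k = prod_encode (j, K)"
  have kK: "k \<ge> K" unfolding k_def by (rule le_prod_encode_2)
  have "x \<notin> unhappy (col k)"
    using K[OF kK] j unfolding flips_def k_def by simp
  then have "card (friends (col k) x) \<le> card (strangers (col k) x)"
    using xs unfolding unhappy_def by auto
  moreover have "friends (col k) x = friends limit_col x" "strangers (col k) x = strangers limit_col x"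
    using K[OF kK] unfolding friends_def strangers_def by auto
  ultimately show ?thesis by simp
qed

text \<open>Since \<open>core\<close> is closed under taking neighbours, its vertices keep their
  full neighbourhoods in the induced graph.\<close>

lemma borel_unfriendly_limit_col:
  "borel_unfriendly_coloring (restrict_space M core) (induced_graph G core) (indicator limit_col)"
  unfolding borel_unfriendly_coloring_def unfriendly_coloring_def
proof (intro conjI ballI)
  show "indicator limit_col \<in> space (restrict_space M core) \<rightarrow> {0, 1 :: nat}"
    by (auto simp: indicator_def)
  show "indicator limit_col \<in> measurable (restrict_space M core) (count_space {0, 1 :: nat})"
  proof (rule measurable_restrict_space1)
    show "indicator limit_col \<in> measurable M (count_space {0, 1 :: nat})"
    proof (rule measurable_count_space_eq2[THEN iffD2], simp, intro conjI ballI)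
      show "indicator limit_col \<in> space M \<rightarrow> {0, 1 :: nat}" by (auto simp: indicator_def)
      have "(\<lambda>x. if x \<in> limit_col then 1 else 0 :: nat) \<in> measurable M (count_space UNIV)" by measurable
      moreover have "(\<lambda>x. if x \<in> limit_col then 1 else 0 :: nat) = indicator limit_col"
        by (auto simp: indicator_def)
      ultimately have "(indicator limit_col :: 'a \<Rightarrow> nat) \<in> measurable M (count_space UNIV)"
        by (simp only:)
      then show "indicator limit_col -` {a} \<inter> space M \<in> sets M" for a :: nat
        by (rule measurable_sets) simp
    qed
  qed
next
  fix x assume "x \<in> space (restrict_space M core)"
  then have x: "x \<in> core" by (simp add: space_restrict_space)
  have nb: "induced_graph G core `` {x} = G `` {x}"
    unfolding induced_graph_def using x core_closed by blast
  have "{y \<in> G `` {x}. (indicator limit_col x :: nat) = indicator limit_col y} = friends limit_col x"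
    "{y \<in> G `` {x}. (indicator limit_col x :: nat) \<noteq> indicator limit_col y} = strangers limit_col x"
    unfolding friends_def strangers_def by (auto simp: indicator_def split: if_splits)
  then show "card {y \<in> induced_graph G core `` {x}. (indicator limit_col x :: nat) = indicator limit_col y}
      \<le> card {y \<in> induced_graph G core `` {x}. (indicator limit_col x :: nat) \<noteq> indicator limit_col y}"
    using limit_col_happy[OF x] by (simp only: nb)
qed

end

section \<open>Deduction from the hypotheses\<close>

text \<open>Adding the identity, itself a measure-preserving involution, makes the family nonempty,
  so a sequence enumerates it even when \<open>F\<close> is empty.\<close>

lemma mp_graph_enumeration:
  assumes "mp_graph M G"
  obtains f :: "nat \<Rightarrow> 'a \<Rightarrow> 'a"
  where "\<And>n. mp_involution M (f n)" and "\<And>x y. (x, y) \<in> G \<Longrightarrow> \<exists>n. y = f n x"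
proof -
  obtain F where F: "countable F" "\<And>f. f \<in> F \<Longrightarrow> mp_involution M f"
    "G \<subseteq> (\<Union>f\<in>F. {(x, f x) | x. x \<in> space M})"
    using assms unfolding mp_graph_def by blast
  have "mp_involution M (\<lambda>x. x)" unfolding mp_involution_def by (simp add: distr_id)
  then have inv: "\<And>f. f \<in> insert (\<lambda>x. x) F \<Longrightarrow> mp_involution M f" using F(2) by blast
  have range: "range (from_nat_into (insert (\<lambda>x. x) F)) = insert (\<lambda>x. x) F"
    using F(1) by (intro range_from_nat_into) auto
  show thesis
  proof (rule that)
    show "mp_involution M (from_nat_into (insert (\<lambda>x. x) F) n)" for n
      by (rule inv) (rule from_nat_into, simp)
    show "\<exists>n. y = from_nat_into (insert (\<lambda>x. x) F) n x" if xy: "(x, y) \<in> G" for x y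
    proof -
      obtain g where g: "g \<in> F" "y = g x" using F(3) xy by blast
      then obtain n where "g = from_nat_into (insert (\<lambda>x. x) F) n"
        using range by (metis insertCI rangeE)
      then show ?thesis using g by blast
    qed
  qed
qed

theorem theorem1:
  fixes M :: "'a measure" and G :: "('a \<times> 'a) set"
  assumes "standard_prob_space M"
    and "borel_graph M G"
    and "locally_finite_graph (space M) G"
    and "mp_graph M G"
    and "graph_cost M G < \<infinity>"
  shows "\<exists>A c. A \<in> sets M \<and> invariant_set (space M) G A \<and> emeasure M (space M - A) = 0 \<and>
           borel_unfriendly_coloring (restrict_space M A) (induced_graph G A) c"
proof -
  obtain U :: "nat \<Rightarrow> 'a set" where U: "\<And>k. U k \<in> sets M"
    "\<And>x Y. x \<in> space M \<Longrightarrow> finite Y \<Longrightarrow> x \<notin> Y \<Longrightarrow> \<exists>k. x \<in> U k \<and> U k \<inter> Y = {}"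
    using assms(1) standard_borel_separating_sets unfolding standard_prob_space_def by metis
  obtain f :: "nat \<Rightarrow> 'a \<Rightarrow> 'a" where f: "\<And>n. mp_involution M (f n)"
    "\<And>x y. (x, y) \<in> G \<Longrightarrow> \<exists>n. y = f n x"
    using mp_graph_enumeration[OF assms(4)] by metis
  interpret prob_space M using assms(1) unfolding standard_prob_space_def by blast
  interpret mp_borel_graph M G f U
    by unfold_locales
      (use assms(2,3) f U in \<open>auto simp: borel_graph_def locally_finite_graph_def mp_involution_def\<close>)
  have "(\<integral>\<^sup>+x. of_nat (card (G `` {x})) \<partial>M) < \<infinity>"
    using assms(5) unfolding graph_cost_def by (auto simp: ennreal_mult_less_top less_top)
  then show ?thesis
    using core_sets invariant_core emeasure_core_compl borel_unfriendly_limit_col by blast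
qed

end
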